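(* Let $n\ge 1$ and $m\ge 2$ be integers, $\mathcal{X}$ a set of inputs, $\boldsymbol{I}:\mathcal{X}\to\mathbb{R}^n$ the (known) feature map, and let $W_S=(w_{ij})\in\mathbb{R}^{n\times m}$ and $\boldsymbol{b}_S\in\mathbb{R}^m$ be the weight matrix and bias vector of the last layer of the student network, whose output is $\mathcal{O}_\theta(\boldsymbol{x})=\mathrm{Softmax}(\boldsymbol{I}(\boldsymbol{x})^TW_S+\boldsymbol{b}_S)$. Let $i_0\in\{1,\dots,n\}$, $j_0\in\{1,\dots,m\}$, and let $\boldsymbol{x}\in\mathcal{X}$ be a non-vanishing input for $i_0$, i.e. $I_{i_0}:=I_{i_0}(\boldsymbol{x})\neq 0$. Let $z_{j_0}$ be the correct value of $\mathcal{O}_{\theta,j_0}(\boldsymbol{x})$, and let $\tilde z_{j_0}$ be the value of $\mathcal{O}_{\theta,j_0}(\boldsymbol{x})$ when a SNIFF on the weight $w_{i_0j_0}$ is carried out. Then \[ w_{i_0j_0}=\frac{1}{2I_{i_0}}\ln\left(\frac{\tilde z_{j_0}^{-1}-1}{z_{j_0}^{-1}-1}\right). \]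
   Context: All computations are in exact real arithmetic. The student network consists of a fixed known feature map $\boldsymbol{I}=(I_1,\dots,I_n):\mathcal{X}\to\mathbb{R}^n$ (the first $k-1$ layers of a public teacher network) followed by one fully connected layer with weights $W_S\in\mathbb{R}^{n\times m}$ and biases $\boldsymbol{b}_S\in\mathbb{R}^m$. For an input $\boldsymbol{x}$, put $y_j(\boldsymbol{x})=b_{S,j}+\sum_{i=1}^n I_i(\boldsymbol{x})w_{ij}$ for $j=1,\dots,m$. With softmax activation the $j$-th output is $\mathcal{O}_{\theta,j}(\boldsymbol{x})=\exp(y_j(\boldsymbol{x}))/\sum_{j'=1}^m\exp(y_{j'}(\boldsymbol{x}))$. SNIFF (sign bit flip fault) on the weight $w_{i_0j_0}$: during the execution on $\boldsymbol{x}$, the product $I_{i_0}(\boldsymbol{x})w_{i_0j_0}$ is replaced by $-I_{i_0}(\boldsymbol{x})w_{i_0j_0}$ in the computation of $y_{j_0}$; everything else (in particular $y_j$ for $j\ne j_0$) is unchanged, and the activation is then applied to the resulting vector. *)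

theory Defs
  imports "HOL-Analysis.Analysis"
begin

definition softmax :: "real ^ 'm \<Rightarrow> real ^ 'm" where
  "softmax y = (\<chi> j. exp (y $ j) / (\<Sum>j'\<in>UNIV. exp (y $ j')))"

(* The layer is split into the individual products v_i * w_ij and their accumulation,
   because the fault acts on a single product. A matrix of type real ^ 'm ^ 'n has
   its rows indexed by 'n and its columns by 'm. *)
definition layer_products :: "real ^ 'n \<Rightarrow> real ^ 'm ^ 'n \<Rightarrow> real ^ 'm ^ 'n" where
  "layer_products v W = (\<chi> i j. v $ i * W $ i $ j)"

definition accumulate :: "real ^ 'm \<Rightarrow> real ^ 'm ^ 'n \<Rightarrow> real ^ 'm" where
  "accumulate b P = (\<chi> j. b $ j + (\<Sum>i\<in>UNIV. P $ i $ j))"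

definition sign_flip :: "'n \<Rightarrow> 'm \<Rightarrow> real ^ 'm ^ 'n \<Rightarrow> real ^ 'm ^ 'n" where
  "sign_flip i0 j0 P = (\<chi> i j. if i = i0 \<and> j = j0 then - (P $ i $ j) else P $ i $ j)"

definition student_output ::
  "('x \<Rightarrow> real ^ 'n) \<Rightarrow> real ^ 'm ^ 'n \<Rightarrow> real ^ 'm \<Rightarrow> 'x \<Rightarrow> real ^ 'm" where
  "student_output I W b x = softmax (accumulate b (layer_products (I x) W))"

definition sniff_output ::
  "'n \<Rightarrow> 'm \<Rightarrow> ('x \<Rightarrow> real ^ 'n) \<Rightarrow> real ^ 'm ^ 'n \<Rightarrow> real ^ 'm \<Rightarrow> 'x \<Rightarrow> real ^ 'm" where
  "sniff_output i0 j0 I W b x =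
     softmax (accumulate b (sign_flip i0 j0 (layer_products (I x) W)))"

lemma student_output_eq: "student_output I W b x = softmax (I x v* W + b)"
proof -
  have "accumulate b (layer_products (I x) W) = I x v* W + b"
    by (simp add: vec_eq_iff accumulate_def layer_products_def vector_matrix_mult_def
        mult.commute add.commute)
  then show ?thesis
    by (simp add: student_output_def)
qed

end

theory Submission
  imports Defs
begin

text \<open>The reciprocal of a softmax output exceeds 1 by
  (the sum over the other neurons) divided by the exponential of its own preactivation. The fault
  leaves the former unchanged and shifts the preactivation by -2 times the product, so the
  quotient of the two excesses is the exponential of twice the product.\<close>

lemma inverse_softmax_minus_one:
  "inverse (softmax y $ j) - 1 = (\<Sum>j'\<in>UNIV - {j}. exp (y $ j')) / exp (y $ j)"
proof -
  have "(\<Sum>j'\<in>UNIV. exp (y $ j')) = exp (y $ j) + (\<Sum>j'\<in>UNIV - {j}. exp (y $ j'))"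
    by (simp add: sum.remove)
  then show ?thesis
    by (simp add: softmax_def add_divide_distrib)
qed

lemma accumulate_sign_flip:
  "accumulate b (sign_flip i0 j0 P) $ j
     = accumulate b P $ j - (if j = j0 then 2 * P $ i0 $ j0 else 0)"
proof (cases "j = j0")
  case True
  have "(\<Sum>i\<in>UNIV. sign_flip i0 j0 P $ i $ j0)
      = - (P $ i0 $ j0) + (\<Sum>i\<in>UNIV - {i0}. P $ i $ j0)"
    by (simp add: sign_flip_def sum.remove[of UNIV i0])
  moreover have "(\<Sum>i\<in>UNIV. P $ i $ j0) = P $ i0 $ j0 + (\<Sum>i\<in>UNIV - {i0}. P $ i $ j0)"
    by (simp add: sum.remove)
  ultimately show ?thesis
    using True by (simp add: accumulate_def)
next
  case False
  then show ?thesis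
    by (simp add: accumulate_def sign_flip_def)
qed

theorem theorem2:
  fixes X :: "'x set"
    and I :: "'x \<Rightarrow> real ^ 'n"
    and W :: "real ^ 'm ^ 'n"
    and b :: "real ^ 'm"
    and i0 :: 'n and j0 :: 'm
    and x :: 'x
    and z z' :: real
  assumes "CARD('m) \<ge> 2"
    and "x \<in> X"
    and "I x $ i0 \<noteq> 0"
    and "z = student_output I W b x $ j0"
    and "z' = sniff_output i0 j0 I W b x $ j0"
  shows "W $ i0 $ j0 = 1 / (2 * I x $ i0) * ln ((inverse z' - 1) / (inverse z - 1))"
proof -
  define y where "y = accumulate b (layer_products (I x) W)"
  define S where "S = (\<Sum>j\<in>UNIV - {j0}. exp (y $ j))"
  define p where "p = I x $ i0 * W $ i0 $ j0"
  have "card (UNIV - {j0}) \<noteq> 0"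
    using assms(1) by (simp add: card_Diff_singleton)
  then have "UNIV - {j0} \<noteq> {}"
    by (metis card.empty)
  \<comment> \<open>With a single neuron both outputs would be 1 and the quotient would degenerate to 0/0.\<close>
  then have S: "S > 0"
    unfolding S_def by (intro sum_pos) auto
  have "inverse z - 1 = S / exp (y $ j0)"
    by (simp add: assms(4) student_output_def inverse_softmax_minus_one S_def y_def)
  moreover have "inverse z' - 1 = S / exp (y $ j0 - 2 * p)"
    by (simp add: assms(5) sniff_output_def inverse_softmax_minus_one S_def y_def p_def
        accumulate_sign_flip layer_products_def)
  ultimately have "(inverse z' - 1) / (inverse z - 1) = exp (2 * p)"
    using S by (simp add: exp_diff)
  then show ?thesis
    using assms(3) by (simp add: p_def)
qed

end
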